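(* Let $$\mathbf{a}=\frac{480\pi^6-40320\pi^4+3628800}{\pi^8}\ (=17.15041\ldots),$$ and for real $x$ put $$a(x)=\frac{8}{945}x^2,\qquad b_1(x)=\frac{8}{945}x^2-\frac{\mathbf{a}}{14175}x^4 .$$ Then for every $x\in\left(0,\frac{\pi}{2}\right)$ the following inequalities hold: $$2+\left(\frac{8}{45}-a(x)\right)x^3\tan x<\left(\frac{\sin x}{x}\right)^{2}+\frac{\tan x}{x}<2+\left(\frac{8}{45}-b_1(x)\right)x^3\tan x .$$
   Context: All quantities are real. The bold symbol $\mathbf{a}$ denotes a constant and is distinct from the function $a(x)$. *)

theory Defs
  imports Complex_Main
begin

definition bold_a :: real
  where "bold_a = (480 * pi ^ 6 - 40320 * pi ^ 4 + 3628800) / pi ^ 8"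

definition a :: "real \<Rightarrow> real"
  where "a x = 8 / 945 * x ^ 2"

definition b\<^sub>1 :: "real \<Rightarrow> real"
  where "b\<^sub>1 x = 8 / 945 * x ^ 2 - bold_a / 14175 * x ^ 4"

end

theory Submission
  imports Defs
begin

text \<open>
  Multiplying out the difference between the middle and the left-hand term produces
  \<open>N x * tan x / x\<^sup>2\<close>, where \<open>N\<close> is the function \<open>wilker_excess\<close> below. Since the tangent is positive,
  the two inequalities together say that \<open>0 < N x / x\<^sup>9 < \<^bold>a / 14175\<close>. The constant \<open>\<^bold>a\<close> is exactly
  the one for which the upper bound becomes an equality at \<open>pi / 2\<close>. The upper inequality therefore
  cannot follow from a crude estimate near \<open>pi / 2\<close>; it holds because \<open>N x / x\<^sup>9\<close> is strictly
  increasing up to \<open>pi / 2\<close>.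

  What remains are two sign conditions: \<open>N x > 0\<close> and \<open>x * N' x - 9 * N x > 0\<close>, the
  second being the sign of the derivative of the quotient. After multiplication by
  \<open>sin x\<close> and by \<open>(sin x)\<^sup>2\<close> respectively, and after replacing products of sines and cosines by
  multiple angles, both become inequalities that are linear in sines and cosines of multiples of
  \<open>x\<close>, with polynomial coefficients. Their Taylor expansions start with
  \<open>16 / 14175 * x\<^sup>1\<^sup>0\<close> and \<open>16 / 467775 * x\<^sup>1\<^sup>3\<close>, and they stay positive on the whole
  of \<open>0 < x < 2\<close>, beyond the range of interest. Bounding each sine and cosine from the
  appropriate side by a Taylor polynomial therefore proves them (\<open>lower_trig_poly_pos\<close> and
  \<open>upper_trig_poly_pos\<close>), and \<open>pi / 2 < 2\<close> is all that has to be known about the size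
  of \<open>pi\<close>.
\<close>

section \<open>Alternating Taylor bounds for sine and cosine\<close>

definition sin_taylor :: "nat \<Rightarrow> real \<Rightarrow> real"
  where "sin_taylor n x = (\<Sum>k<n. (-1) ^ k * x ^ (2 * k + 1) / fact (2 * k + 1))"

definition cos_taylor :: "nat \<Rightarrow> real \<Rightarrow> real"
  where "cos_taylor n x = (\<Sum>k<n. (-1) ^ k * x ^ (2 * k) / fact (2 * k))"

lemma power_over_fact_deriv:
  "((\<lambda>x::real. c * x ^ Suc m / fact (Suc m)) has_real_derivative c * x ^ m / fact m) (at x)"
proof -
  have "((\<lambda>x. c * x ^ Suc m / fact (Suc m)) has_real_derivative
      c * (real (Suc m) * x ^ m) / fact (Suc m)) (at x)"
    using DERIV_pow [of "Suc m" x] by (intro DERIV_cdivide DERIV_cmult) simp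
  moreover have "c * (real (Suc m) * x ^ m) / fact (Suc m) = c * x ^ m / fact m"
    by (simp add: fact_Suc del: of_nat_Suc)
  ultimately show ?thesis by simp
qed

lemma sin_taylor_deriv: "(sin_taylor n has_real_derivative cos_taylor n x) (at x)"
proof -
  have "((\<lambda>x. (-1) ^ k * x ^ (2 * k + 1) / fact (2 * k + 1)) has_real_derivative
      (-1) ^ k * x ^ (2 * k) / fact (2 * k)) (at x)" for k
    using power_over_fact_deriv [of "(-1) ^ k" "2 * k"] by simp
  then show ?thesis
    unfolding sin_taylor_def [abs_def] cos_taylor_def by (intro DERIV_sum)
qed

lemma cos_taylor_deriv: "(cos_taylor (Suc n) has_real_derivative - sin_taylor n x) (at x)"
proof -
  have "((\<lambda>x. (-1) ^ Suc k * x ^ (2 * Suc k) / fact (2 * Suc k)) has_real_derivative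
      - ((-1) ^ k * x ^ (2 * k + 1) / fact (2 * k + 1))) (at x)" for k
    using power_over_fact_deriv [of "(-1) ^ Suc k" "2 * k + 1"] by simp
  then have "((\<lambda>x. 1 + (\<Sum>k<n. (-1) ^ Suc k * x ^ (2 * Suc k) / fact (2 * Suc k)))
      has_real_derivative 0 + (\<Sum>k<n. - ((-1) ^ k * x ^ (2 * k + 1) / fact (2 * k + 1)))) (at x)"
    by (intro DERIV_add DERIV_const DERIV_sum)
  moreover have "cos_taylor (Suc n) =
      (\<lambda>x. 1 + (\<Sum>k<n. (-1) ^ Suc k * x ^ (2 * Suc k) / fact (2 * Suc k)))"
    unfolding cos_taylor_def by (rule ext, subst sum.lessThan_Suc_shift) simp
  ultimately show ?thesis
    by (simp add: sin_taylor_def sum_negf)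
qed

text \<open>
  Up to sign, each remainder is the derivative of the next one in the order
  \<open>cos\<close>, \<open>sin\<close>, \<open>cos\<close>, and so on, and all of them vanish at \<open>0\<close>. So the sign
  of the first, \<open>cos x - 1 \<le> 0\<close>, propagates along the chain. The empty Taylor
  polynomial has to be excluded, because \<open>cos\<close> and \<open>sin\<close> themselves change sign.
\<close>

lemma taylor_remainder_sign:
  assumes "0 \<le> x"
  shows "0 \<le> (-1) ^ Suc n * (cos x - cos_taylor (Suc n) x)"
    and "0 \<le> (-1) ^ Suc n * (sin x - sin_taylor (Suc n) x)"
proof -
  have zero: "sin_taylor n 0 = 0" "cos_taylor (Suc n) 0 = 1" for n
    by (simp_all add: sin_taylor_def cos_taylor_def sum.lessThan_Suc_shift del: sum.lessThan_Suc)
  have mono: "0 \<le> f x"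
    if "0 \<le> x" "f 0 = 0" "\<And>t. 0 \<le> t \<Longrightarrow> (f has_real_derivative f' t) (at t)"
      "\<And>t. 0 \<le> t \<Longrightarrow> 0 \<le> f' t" for f f' :: "real \<Rightarrow> real" and x
    using DERIV_nonneg_imp_nondecreasing [of 0 x f] that by force
  have sin_step: "0 \<le> (-1) ^ Suc n * (sin x - sin_taylor (Suc n) x)"
    if "0 \<le> x" "\<And>t. 0 \<le> t \<Longrightarrow> 0 \<le> (-1) ^ Suc n * (cos t - cos_taylor (Suc n) t)" for n x
    by (rule mono [where f = "\<lambda>t. (-1) ^ Suc n * (sin t - sin_taylor (Suc n) t)", OF that(1) _ _ that(2)])
      (auto intro!: derivative_eq_intros sin_taylor_deriv simp: zero)
  have cos_step: "0 \<le> (-1) ^ Suc (Suc n) * (cos x - cos_taylor (Suc (Suc n)) x)"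
    if "0 \<le> x" "\<And>t. 0 \<le> t \<Longrightarrow> 0 \<le> (-1) ^ Suc n * (sin t - sin_taylor (Suc n) t)" for n x
    by (rule mono [where f = "\<lambda>t. (-1) ^ Suc (Suc n) * (cos t - cos_taylor (Suc (Suc n)) t)",
          OF that(1) _ _ that(2)])
      (auto intro!: derivative_eq_intros cos_taylor_deriv simp: zero algebra_simps)
  have cos_sign: "\<And>x. 0 \<le> x \<Longrightarrow> 0 \<le> (-1) ^ Suc n * (cos x - cos_taylor (Suc n) x)"
  proof (induction n)
    case 0
    show ?case by (simp add: cos_taylor_def)
  next
    case (Suc n)
    then show ?case by (intro cos_step sin_step)
  qed
  from cos_sign [OF assms] show "0 \<le> (-1) ^ Suc n * (cos x - cos_taylor (Suc n) x)" .
  from sin_step [OF assms cos_sign]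
  show "0 \<le> (-1) ^ Suc n * (sin x - sin_taylor (Suc n) x)" .
qed

lemma taylor_bounds:
  assumes "0 \<le> x" "0 < n"
  shows sin_taylor_le: "even n \<Longrightarrow> sin_taylor n x \<le> sin x"
    and sin_le_taylor: "odd n \<Longrightarrow> sin x \<le> sin_taylor n x"
    and cos_taylor_le: "even n \<Longrightarrow> cos_taylor n x \<le> cos x"
    and cos_le_taylor: "odd n \<Longrightarrow> cos x \<le> cos_taylor n x"
  using taylor_remainder_sign [OF assms(1), of "n - 1"] assms(2) by simp_all

section \<open>Positivity of two trigonometric polynomials\<close>

lemmas taylor_expand = sin_taylor_def cos_taylor_def lessThan_nat_numeral fact_numeral

text \<open>
  The expression is \<open>sin x\<close> times the excess over the lower bound. The Taylor polynomials are the
  shortest ones of the required parity that preserve its leading term, of degree \<open>10\<close>.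
  They leave only one further term, of degree \<open>12\<close>, whose coefficient is small enough
  for \<open>x\<^sup>2 < 4\<close>.
\<close>

lemma lower_trig_poly_pos:
  fixes x :: real
  assumes "0 < x" "x < 2"
  shows "0 < (cos x - cos (3 * x)) / 4 + x * sin x - 2 * x ^ 2 * cos x
    - (8 / 45 * x ^ 5 - 8 / 945 * x ^ 7) * sin x" (is "0 < ?L")
proof -
  have "x ^ 2 < 2 ^ 2"
    using assms by (intro power_strict_mono) auto
  then have z: "x ^ 2 < 4" by simp
  have c1: "cos_taylor 6 x \<le> cos x" and c3: "cos (3 * x) \<le> cos_taylor 7 (3 * x)"
    using assms by (simp_all add: taylor_bounds)
  have s1: "x * sin_taylor 6 x \<le> x * sin x"
    and c1': "x ^ 2 * cos x \<le> x ^ 2 * cos_taylor 5 x"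
    and s1': "x ^ 5 * sin x \<le> x ^ 5 * sin_taylor 3 x"
    and s1'': "x ^ 7 * sin_taylor 2 x \<le> x ^ 7 * sin x"
    using assms by (auto intro!: mult_left_mono taylor_bounds)
  have "0 < x ^ 10 * (16 / 14175 - 25309 / 91238400 * x ^ 2)"
    using assms(1) z by (intro mult_pos_pos) auto
  also have "\<dots> = (cos_taylor 6 x - cos_taylor 7 (3 * x)) / 4 + x * sin_taylor 6 x
      - 2 * (x ^ 2 * cos_taylor 5 x) - 8 / 45 * (x ^ 5 * sin_taylor 3 x)
      + 8 / 945 * (x ^ 7 * sin_taylor 2 x)"
    by (simp add: taylor_expand power_mult_distrib field_simps) algebra
  also have "\<dots> \<le> (cos x - cos (3 * x)) / 4 + x * sin x
      - 2 * (x ^ 2 * cos x) - 8 / 45 * (x ^ 5 * sin x) + 8 / 945 * (x ^ 7 * sin x)"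
    using divide_right_mono [OF diff_mono [OF c1 c3], of 4] s1 c1' s1' s1'' by linarith
  also have "\<dots> = ?L"
    by (simp add: algebra_simps)
  finally show ?thesis .
qed

text \<open>
  Writing these products as sums of monomials in \<open>x\<close> keeps the long polynomial identity in the next
  proof a matter of collecting coefficients.
\<close>

lemma power_mult_taylor:
  shows power_mult_sin_taylor: "x ^ m * sin_taylor n (c * x) =
      (\<Sum>k<n. (-1) ^ k * c ^ (2 * k + 1) / fact (2 * k + 1) * x ^ (2 * k + 1 + m))"
    and power_mult_cos_taylor: "x ^ m * cos_taylor n (c * x) =
      (\<Sum>k<n. (-1) ^ k * c ^ (2 * k) / fact (2 * k) * x ^ (2 * k + m))"
  unfolding sin_taylor_def cos_taylor_def sum_distrib_left
  by (intro sum.cong refl; simp add: power_mult_distrib power_add)+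

text \<open>
  The expression is \<open>(sin x)\<^sup>2\<close> times \<open>x * N' x - 9 * N x\<close>, with \<open>N\<close> the excess over the lower bound.
  The Taylor polynomials are the shortest ones of the required parity that reproduce all terms
  up to degree \<open>21\<close>, and at degree \<open>23\<close> they leave a negative error. In contrast to the
  previous lemma the leading term is less dominant, so the six remaining terms are
  grouped in threes: in each group the positive terms outweigh the negative ones for
  \<open>x\<^sup>2 < 4\<close>.
\<close>

lemma upper_trig_poly_pos:
  fixes x :: real
  assumes "0 < x" "x < 2"
  shows "0 < - 17 / 4 * x + 2 * x ^ 3 + (16 / 45 * x ^ 5 - 8 / 945 * x ^ 7) * (1 - cos (2 * x))
    + 9 / 2 * x * cos (2 * x) - 1 / 4 * x * cos (4 * x) + 7 * x ^ 2 * sin (2 * x)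
    - 9 / 4 * sin (2 * x) + 9 / 8 * sin (4 * x)" (is "0 < ?M")
proof -
  have "x ^ 2 < 2 ^ 2"
    using assms by (intro power_strict_mono) auto
  then have z: "x ^ 2 < 4" by simp
  have z4a: "x ^ 4 \<le> 4 * x ^ 2"
    using mult_right_mono [of "x ^ 2" 4 "x ^ 2"] z by simp
  with z have z4b: "x ^ 4 < 16" by simp
  have s2: "sin (2 * x) \<le> sin_taylor 11 (2 * x)" and s4: "sin_taylor 12 (4 * x) \<le> sin (4 * x)"
    using assms by (simp_all add: taylor_bounds)
  have t: "x * cos_taylor 12 (2 * x) \<le> x * cos (2 * x)"
    "x * cos (4 * x) \<le> x * cos_taylor 11 (4 * x)"
    "x ^ 2 * sin_taylor 10 (2 * x) \<le> x ^ 2 * sin (2 * x)"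
    "x ^ 5 * cos (2 * x) \<le> x ^ 5 * cos_taylor 9 (2 * x)"
    "x ^ 7 * cos_taylor 8 (2 * x) \<le> x ^ 7 * cos (2 * x)"
    using assms by (auto intro!: mult_left_mono taylor_bounds)
  have "0 < 16 / 467775 + 496 / 58046625 * x ^ 2 - 64 / 24877125 * x ^ 4"
    using z z4a by auto
  moreover have "0 \<le> x ^ 6 * (2512 / 8881133625 - 1226128 / 64965492466875 * x ^ 2
      - 5592436 / 1826252177124375 * x ^ 4)"
    using z z4b by (intro mult_nonneg_nonneg) auto
  ultimately have "0 < x ^ 13 * ((16 / 467775 + 496 / 58046625 * x ^ 2 - 64 / 24877125 * x ^ 4)
      + x ^ 6 * (2512 / 8881133625 - 1226128 / 64965492466875 * x ^ 2
      - 5592436 / 1826252177124375 * x ^ 4))"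
    using assms(1) by (intro mult_pos_pos add_pos_nonneg) auto
  also have "\<dots> = - 17 / 4 * x + 2 * x ^ 3 + 16 / 45 * x ^ 5 - 8 / 945 * x ^ 7
    - 16 / 45 * (x ^ 5 * cos_taylor 9 (2 * x)) + 8 / 945 * (x ^ 7 * cos_taylor 8 (2 * x))
    + 9 / 2 * (x * cos_taylor 12 (2 * x)) - 1 / 4 * (x * cos_taylor 11 (4 * x))
    + 7 * (x ^ 2 * sin_taylor 10 (2 * x)) - 9 / 4 * sin_taylor 11 (2 * x)
    + 9 / 8 * sin_taylor 12 (4 * x)"
    unfolding power_mult_cos_taylor power_mult_sin_taylor
      power_mult_cos_taylor [of x 1, unfolded power_one_right]
      power_mult_sin_taylor [of x 0, unfolded power_0 mult_1_left]
    by (simp add: lessThan_nat_numeral fact_numeral algebra_simps del: One_nat_def) algebra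
  also have "\<dots> \<le> - 17 / 4 * x + 2 * x ^ 3 + 16 / 45 * x ^ 5 - 8 / 945 * x ^ 7
    - 16 / 45 * (x ^ 5 * cos (2 * x)) + 8 / 945 * (x ^ 7 * cos (2 * x))
    + 9 / 2 * (x * cos (2 * x)) - 1 / 4 * (x * cos (4 * x))
    + 7 * (x ^ 2 * sin (2 * x)) - 9 / 4 * sin (2 * x) + 9 / 8 * sin (4 * x)"
    using s2 s4 t by linarith
  also have "\<dots> = ?M"
    by (simp add: field_simps)
  finally show ?thesis .
qed

section \<open>The excess over the lower bound\<close>

text \<open>
  This is the difference between the middle and the left-hand term of the theorem, divided by
  \<open>tan x / x\<^sup>2\<close>. Near \<open>0\<close> it behaves like \<open>16 / 14175 * x\<^sup>9\<close>. The division removes the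
  singularity of the tangent, so that the function extends smoothly to \<open>pi / 2\<close>, where the upper
  bound is sharp.
\<close>

definition wilker_excess :: "real \<Rightarrow> real"
  where "wilker_excess x = sin x * cos x + x - 2 * x ^ 2 * (cos x / sin x)
    - 8 / 45 * x ^ 5 + 8 / 945 * x ^ 7"

lemma wilker_excess_pos:
  assumes "0 < x" "x < pi / 2"
  shows "0 < wilker_excess x"
proof -
  have s: "0 < sin x" using assms by (simp add: sin_gt_zero)
  have x2: "x < 2" using assms(2) pi_half_less_two by linarith
  have "(cos x - cos (3 * x)) / 4 = cos x * (sin x) ^ 2"
    by (simp add: cos_treble_cos sin_squared_eq) algebra
  then have "wilker_excess x * sin x = (cos x - cos (3 * x)) / 4 + x * sin x - 2 * x ^ 2 * cos x
    - (8 / 45 * x ^ 5 - 8 / 945 * x ^ 7) * sin x"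
    using s unfolding wilker_excess_def by (simp add: algebra_simps power2_eq_square)
  with lower_trig_poly_pos [OF assms(1) x2] have "0 < wilker_excess x * sin x" by simp
  with s show ?thesis by (simp add: zero_less_mult_iff)
qed

text \<open>
  The derivative has the sign of \<open>x * N' x - 9 * N x\<close>, and multiplying by \<open>(sin x)\<^sup>2\<close> removes the
  cotangent and its derivative, which leaves the trigonometric polynomial of \<open>upper_trig_poly_pos\<close>.
  The endpoint \<open>pi / 2\<close> belongs to the range because the quotient is compared with its value there.
\<close>

lemma wilker_excess_quotient_deriv_pos:
  assumes "0 < x" "x \<le> pi / 2"
  obtains d where "((\<lambda>t. wilker_excess t / t ^ 9) has_real_derivative d) (at x)" "0 < d"
proof -
  have s: "0 < sin x" using assms by (intro sin_gt_zero) auto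
  have x2: "x < 2" using assms(2) pi_half_less_two by linarith
  let ?c = "cos x" and ?s = "sin x"
  let ?n' = "?c ^ 2 - ?s ^ 2 + 1 - 4 * x * (?c / ?s) + 2 * x ^ 2 / ?s ^ 2
    - 8 / 9 * x ^ 4 + 8 / 135 * x ^ 6"
  have cot_deriv: "((\<lambda>t. cos t / sin t) has_real_derivative - 1 / ?s ^ 2) (at x)"
  proof (rule derivative_eq_intros)+
    show "(- ?s * ?s - ?c * ?c) / (?s * ?s) = - 1 / ?s ^ 2"
      using s sin_cos_squared_add [of x]
      by (simp add: power2_eq_square divide_simps)
  qed (use s in auto)
  have n': "(wilker_excess has_real_derivative ?n') (at x)"
    unfolding wilker_excess_def [abs_def]
    by (rule derivative_eq_intros cot_deriv refl)+ (simp add: power2_eq_square)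
  have q': "((\<lambda>t. wilker_excess t / t ^ 9) has_real_derivative
      (x * ?n' - 9 * wilker_excess x) / x ^ 10) (at x)"
    using assms(1) by (auto intro!: derivative_eq_intros n' simp: field_simps eval_nat_numeral)
  have c2: "cos (2 * x) = 1 - 2 * ?s ^ 2" and s2: "sin (2 * x) = 2 * ?s * ?c"
    by (simp_all add: cos_double_sin sin_double)
  have "4 * x = 2 * (2 * x)" by simp
  then have c4: "cos (4 * x) = 1 - 8 * ?s ^ 2 * ?c ^ 2"
    and s4: "sin (4 * x) = 4 * ?s * ?c * (1 - 2 * ?s ^ 2)"
    by (simp_all only: cos_double_sin sin_double s2 c2) (simp_all add: power_mult_distrib cos_double_sin)
  have "?s ^ 2 * (x * ?n' - 9 * wilker_excess x) =
     - 17 / 4 * x + 2 * x ^ 3 + (16 / 45 * x ^ 5 - 8 / 945 * x ^ 7) * (1 - cos (2 * x))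
    + 9 / 2 * x * cos (2 * x) - 1 / 4 * x * cos (4 * x) + 7 * x ^ 2 * sin (2 * x)
    - 9 / 4 * sin (2 * x) + 9 / 8 * sin (4 * x)"
  proof -
    have "?s ^ 2 * (x * ?n' - 9 * wilker_excess x) =
      x * ?s ^ 2 * (?c ^ 2 - ?s ^ 2) - 8 * x * ?s ^ 2 + 14 * x ^ 2 * ?s * ?c
      + 2 * x ^ 3 - 9 * ?s ^ 3 * ?c + (32 / 45 * x ^ 5 - 16 / 945 * x ^ 7) * ?s ^ 2"
      using s by (simp add: wilker_excess_def field_simps eval_nat_numeral)
    then show ?thesis
      using sin_cos_squared_add [of x] unfolding c2 s2 c4 s4
      by algebra
  qed
  with upper_trig_poly_pos [OF assms(1) x2] have "0 < ?s ^ 2 * (x * ?n' - 9 * wilker_excess x)"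
    by simp
  then have "0 < x * ?n' - 9 * wilker_excess x"
    using s by (simp add: zero_less_mult_iff)
  with q' that assms(1) show ?thesis by simp
qed

lemma wilker_excess_pi_half: "wilker_excess (pi / 2) / (pi / 2) ^ 9 = bold_a / 14175"
  unfolding wilker_excess_def bold_a_def
  by (simp add: field_simps flip: power_Suc)

lemma wilker_excess_less:
  assumes "0 < x" "x < pi / 2"
  shows "wilker_excess x < bold_a / 14175 * x ^ 9"
proof -
  have "wilker_excess x / x ^ 9 < wilker_excess (pi / 2) / (pi / 2) ^ 9"
  proof (rule DERIV_pos_imp_increasing [OF assms(2)])
    fix t assume "x \<le> t" "t \<le> pi / 2"
    with assms(1) have "0 < t" by simp
    from this \<open>t \<le> pi / 2\<close> obtain d
      where "((\<lambda>t. wilker_excess t / t ^ 9) has_real_derivative d) (at t)" "0 < d"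
      by (rule wilker_excess_quotient_deriv_pos)
    then show "\<exists>d. ((\<lambda>t. wilker_excess t / t ^ 9) has_real_derivative d) (at t) \<and> 0 < d"
      by blast
  qed
  then show ?thesis
    unfolding wilker_excess_pi_half using assms(1) by (simp add: divide_less_eq)
qed

section \<open>The two-sided inequality\<close>

theorem theorem2p1:
  fixes x :: real
  assumes "x \<in> {0<..<pi / 2}"
  shows "2 + (8 / 45 - a x) * x ^ 3 * tan x < (sin x / x) ^ 2 + tan x / x \<and>
    (sin x / x) ^ 2 + tan x / x < 2 + (8 / 45 - b\<^sub>1 x) * x ^ 3 * tan x"
proof -
  have x: "0 < x" "x < pi / 2" using assms by auto
  have s: "0 < sin x" using x by (simp add: sin_gt_zero)
  have c: "0 < cos x" using x by (simp add: cos_gt_zero)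
  have eq: "(sin x / x) ^ 2 + tan x / x - (2 + (8 / 45 - a x) * x ^ 3 * tan x)
      = wilker_excess x * (tan x / x ^ 2)"
    using x s c by (simp add: wilker_excess_def a_def tan_def divide_simps) algebra
  have t: "0 < tan x / x ^ 2" using x s c by (simp add: tan_def)
  have "0 < wilker_excess x * (tan x / x ^ 2)"
    using wilker_excess_pos [OF x] t by (rule mult_pos_pos)
  moreover have "wilker_excess x * (tan x / x ^ 2) < bold_a / 14175 * x ^ 9 * (tan x / x ^ 2)"
    using wilker_excess_less [OF x] t by (rule mult_strict_right_mono)
  moreover have "bold_a / 14175 * x ^ 9 * (tan x / x ^ 2) = bold_a / 14175 * x ^ 7 * tan x"
    using x by (simp add: field_simps flip: power_add)
  moreover have "(8 / 45 - b\<^sub>1 x) * x ^ 3 * tan x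
      = (8 / 45 - a x) * x ^ 3 * tan x + bold_a / 14175 * x ^ 7 * tan x"
    unfolding a_def b\<^sub>1_def by (simp add: algebra_simps)
  ultimately show ?thesis using eq by linarith
qed

end
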